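(* Let $m,n,k$ be positive integers with $k<\min\{m,n\}$ and let $A\in\mathbb{Z}^{m\times n}$. Let $\mathcal{B}_U\subset\mathbb{Z}^{m\times k}$ and $\mathcal{B}_V\subset\mathbb{Z}^{k\times n}$ be bounded sets, let $V_0\in\mathcal{B}_V$, and let $(U_i)_{i\ge1}$ in $\mathcal{B}_U$ and $(V_i)_{i\ge1}$ in $\mathcal{B}_V$ be sequences produced by alternating minimization restricted to these regions, i.e. for every $i\ge1$, $U_i$ is a minimizer of $\|A-UV_{i-1}\|_F^2$ over $U\in\mathcal{B}_U$ and $V_i$ is a minimizer of $\|A-U_iV\|_F^2$ over $V\in\mathcal{B}_V$. Then there exist $U\in\mathcal{B}_U$ and $V\in\mathcal{B}_V$ such that $$\lim_{i\to\infty}\|A-U_iV_i\|_F=\|A-UV\|_F.$$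
   Context: $\mathbb{Z}^{p\times q}$ denotes the set of $p\times q$ integer matrices and $\|\cdot\|_F$ the Frobenius norm. The setting is the block coordinate descent method for integer low rank approximation: starting from an initial integer matrix $V$, one alternately solves $\min_U\|A-UV\|_F^2$ with $V$ fixed and $\min_V\|A-UV\|_F^2$ with $U$ fixed, over integer matrices restricted to the prescribed feasible regions. *)

theory Defs
  imports "HOL-Analysis.Analysis"
begin

definition frobenius_norm :: "int ^ 'q ^ 'p \<Rightarrow> real" where
  "frobenius_norm M = sqrt (\<Sum>i\<in>UNIV. \<Sum>j\<in>UNIV. (real_of_int (M $ i $ j))\<^sup>2)"

lemma frobenius_norm_eq_norm: "frobenius_norm M = norm (map_matrix real_of_int M)"
  by (simp add: frobenius_norm_def norm_vec_def L2_set_def sum_nonneg)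

text \<open>The type \<^typ>\<open>int\<close> carries no metric in the library, so boundedness is that of the image
  in the normed space of real matrices, whose norm is the Frobenius norm
  by \<open>frobenius_norm_eq_norm\<close>.\<close>

definition bounded_int_matrices :: "(int ^ 'q ^ 'p) set \<Rightarrow> bool" where
  "bounded_int_matrices B \<longleftrightarrow> bounded (map_matrix real_of_int ` B)"

end

theory Submission
  imports Defs
begin

text \<open>Each half step of the alternation minimises the squared error over a set that contains the
  current iterate, so it cannot increase the error, and the error is nonincreasing along the
  pairs \<open>(U i, V i)\<close> with \<open>i \<ge> 1\<close>. Since all matrices are integral, the squared error is moreover
  a natural number. By well-ordering, the squared errors attain a least value at some \<open>N \<ge> 1\<close>, and
  monotonicity keeps them at this value from \<open>N\<close> on. Hence the sequence of errors is
  eventually constant, and its limit is the error of the feasible pair \<open>(U N, V N)\<close>.\<close>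

definition sum_of_squared_entries :: "int ^ 'q ^ 'p \<Rightarrow> nat" where
  "sum_of_squared_entries M = nat (\<Sum>i\<in>UNIV. \<Sum>j\<in>UNIV. (M $ i $ j)\<^sup>2)"

lemma frobenius_norm_eq_sqrt_nat:
  "frobenius_norm M = sqrt (real (sum_of_squared_entries M))"
proof -
  have "0 \<le> (\<Sum>i\<in>UNIV. \<Sum>j\<in>UNIV. (M $ i $ j)\<^sup>2)"
    by (intro sum_nonneg) simp
  then show ?thesis
    by (simp add: frobenius_norm_def sum_of_squared_entries_def)
qed

lemma frobenius_norm_power2:
  "(frobenius_norm M)\<^sup>2 = real (sum_of_squared_entries M)"
  by (simp add: frobenius_norm_eq_sqrt_nat)

text \<open>By well-ordering, the sequence attains its least value on the tail; after that index
  it can neither increase nor decrease.\<close>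

lemma nonincreasing_nat_sequence_stabilizes:
  fixes f :: "nat \<Rightarrow> nat"
  assumes step: "\<And>i. i \<ge> a \<Longrightarrow> f (Suc i) \<le> f i"
  obtains N where "N \<ge> a" and "\<And>i. i \<ge> N \<Longrightarrow> f i = f N"
proof -
  obtain N where N: "N \<ge> a" and least: "\<And>i. i \<ge> a \<Longrightarrow> f N \<le> f i"
    using ex_has_least_nat[of "\<lambda>i. i \<ge> a" a f] by auto
  have "f i = f N" if "i \<ge> N" for i
  proof (rule antisym)
    show "f i \<le> f N"
      using that
    proof (induction i rule: dec_induct)
      case base
      show ?case by simp
    next
      case (step i)
      then show ?case
        using assms[of i] N by linarith
    qed
    show "f N \<le> f i"
      using least N that by simp
  qed
  with N show thesis by (rule that)
qed

theorem theorem3p2: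
  fixes A :: "int ^ 'n ^ 'm"
    and B\<^sub>U :: "(int ^ 'k ^ 'm) set"
    and B\<^sub>V :: "(int ^ 'n ^ 'k) set"
    and U :: "nat \<Rightarrow> int ^ 'k ^ 'm"
    and V :: "nat \<Rightarrow> int ^ 'n ^ 'k"
    and V\<^sub>0 :: "int ^ 'n ^ 'k"
  assumes "CARD('k) < min CARD('m) CARD('n)"
    and "bounded_int_matrices B\<^sub>U"
    and "bounded_int_matrices B\<^sub>V"
    and "V\<^sub>0 \<in> B\<^sub>V"
    and "V 0 = V\<^sub>0"
    and "\<And>i. i \<ge> 1 \<Longrightarrow>
      is_arg_min (\<lambda>X. (frobenius_norm (A - X ** V (i - 1)))\<^sup>2) (\<lambda>X. X \<in> B\<^sub>U) (U i)"
    and "\<And>i. i \<ge> 1 \<Longrightarrow>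
      is_arg_min (\<lambda>Y. (frobenius_norm (A - U i ** Y))\<^sup>2) (\<lambda>Y. Y \<in> B\<^sub>V) (V i)"
  shows "\<exists>U'\<in>B\<^sub>U. \<exists>V'\<in>B\<^sub>V.
    (\<lambda>i. frobenius_norm (A - U i ** V i)) \<longlonglongrightarrow> frobenius_norm (A - U' ** V')"
proof -
  define e where "e i = sum_of_squared_entries (A - U i ** V i)" for i
  have U_feasible: "U i \<in> B\<^sub>U" and V_feasible: "V i \<in> B\<^sub>V" if "i \<ge> 1" for i
    using assms(6,7)[OF that] by (auto simp: is_arg_min_def)
  have step: "e (Suc i) \<le> e i" if "i \<ge> 1" for i
  proof -
    have "e (Suc i) \<le> sum_of_squared_entries (A - U (Suc i) ** V i)"
      using assms(7)[of "Suc i"] V_feasible[OF that]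
      by (force simp: e_def is_arg_min_def frobenius_norm_power2)
    also have "\<dots> \<le> e i"
      using assms(6)[of "Suc i"] U_feasible[OF that]
      by (force simp: e_def is_arg_min_def frobenius_norm_power2)
    finally show ?thesis .
  qed
  obtain N where N: "N \<ge> 1" and const: "\<And>i. i \<ge> N \<Longrightarrow> e i = e N"
    using nonincreasing_nat_sequence_stabilizes[of 1 e] step by blast
  have "frobenius_norm (A - U i ** V i) = frobenius_norm (A - U N ** V N)" if "i \<ge> N" for i
    using const[OF that] by (simp add: e_def frobenius_norm_eq_sqrt_nat)
  then have "(\<lambda>i. frobenius_norm (A - U i ** V i)) \<longlonglongrightarrow> frobenius_norm (A - U N ** V N)"
    by (intro tendsto_eventually eventually_sequentiallyI)
  then show ?thesis
    using U_feasible[OF N] V_feasible[OF N] by blast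
qed

end
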